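(* Let $\mathbf{y}_n\in\mathbb{R}^d$, $h>0$, $\varepsilon>0$, and let $\mathbf{Y}_1,\dots,\mathbf{Y}_s,\mathbf{y}^{\{p\}}_{n+1}\in\mathbb{R}^d$ be the stages and the predicted solution (possibly with negative entries) of an SDIRK method with non-negative weights $b_1,\dots,b_s\ge 0$ applied with step size $h$ from $\mathbf{y}_n$ to the graph Laplacian system $\mathbf{y}'=\mathbf{G}(\mathbf{y})\,\mathbf{y}$: $$\mathbf{Y}_i=\mathbf{y}_n+h\sum_{j=1}^{i}a_{i,j}\,\mathbf{G}(\mathbf{Y}_j)\,\mathbf{Y}_j\ \ (i=1,\dots,s),\qquad \mathbf{y}^{\{p\}}_{n+1}=\mathbf{y}_n+h\sum_{j=1}^{s}b_j\,\mathbf{G}(\mathbf{Y}_j)\,\mathbf{Y}_j.$$ Set $$\overline{\mathbf{G}}=\sum_{j=1}^{s}b_j\,\mathbf{G}(\breve{\mathbf{Y}}_j)\,\boldsymbol{\Sigma}_{\mathbf{Y}_j/\mathbf{y}^{\{p\}}_{n+1}}.$$ Then $\overline{\mathbf{G}}$ is a graph Laplacian matrix with $\mathbf{w}_j^T\overline{\mathbf{G}}=\mathbf{0}$ for $j=1,\dots,M$; the matrix $\mathbf{I}_{d\times d}-h\,\overline{\mathbf{G}}$ is an invertible $M$-matrix whose inverse has only non-negative entries; and the corrected solution $$\mathbf{y}_{n+1}=\big(\mathbf{I}_{d\times d}-h\,\overline{\mathbf{G}}\big)^{-1}\mathbf{y}_n$$ satisfies: (1) $\mathbf{y}_n\succeq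 0$ implies $\mathbf{y}_{n+1}\succeq 0$; (2) $\mathbf{y}_n\succ 0$ implies $\mathbf{y}_{n+1}\succ 0$; (3) $\mathbf{w}_j^T\mathbf{y}_{n+1}=\mathbf{w}_j^T\mathbf{y}_n$ for all $j=1,\dots,M$.
   Context: Notation: $\succeq 0$ (resp. $\succ 0$) means that all components are $\ge 0$ (resp. $>0$). $\mathbf{I}_{d\times d}$ is the identity matrix and $\boldsymbol{1}_d\in\mathbb{R}^d$ is the vector of ones. System: $\mathbf{y}'=\mathbf{G}(t,\mathbf{y})\,\mathbf{y}$ in $\mathbb{R}^d$ with $\mathbf{G}(t,\mathbf{y})\in\mathbb{R}^{d\times d}$; in the numerical formulas the argument $t$ is suppressed. Standing assumptions on $\mathbf{G}$: (i) the eigenvalues of $\mathbf{G}(t,\mathbf{y})$ have non-positive real parts for all $t,\mathbf{y}$; (ii) $\mathbf{G}_{i,i}(t,\mathbf{y})\le 0$ for all $i$ and $\mathbf{G}_{i,j}(t,\mathbf{y})\ge 0$ for all $i\ne j$, for all $t\ge t_0$ and all $\mathbf{y}\succeq 0$; (iii) there are vectors $\mathbf{w}_1,\dots,\mathbf{w}_M\in\mathbb{R}^d$, $M<d$, with $\mathbf{w}_j^T\mathbf{G}(t,\mathbf{y})=\mathbf{0}$ for all $t,\mathbf{y}$, where $\mathbf{w}_1=\boldsymbol{1}_d$. A matrix is called a graph Laplacian matrix if its diagonal entries are non-positive, its off-diagonal entries are non-negative, and each of its columns sums to zero. SDIRK method: $s$-stage singly diagonally implicit Runge-Kutta method with coefficients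 $a_{i,j}$ ($j\le i$), equal diagonal entries $a_{i,i}$, and weights $b_j$; it is stiffly accurate, i.e. $b_j=a_{s,j}$ for all $j$. The stages are any solution of the implicit stage equations. $M$-matrix: a matrix with positive diagonal entries, non-positive off-diagonal entries, and all eigenvalues in the open right half-plane. Clipping: $\breve{\mathbf{Y}}=\mathrm{clip}(\mathbf{Y})$ has components $\breve{\mathbf{Y}}_\ell=\max(\mathbf{Y}_\ell,0)$, $\ell=1,\dots,d$. Ratio scaling: for $\mathbf{Y},\mathbf{Z}\in\mathbb{R}^d$ and a fixed threshold $\varepsilon>0$, $\boldsymbol{\Sigma}_{\mathbf{Y}/\mathbf{Z}}=\mathrm{diag}_{\ell=1,\dots,d}\ \dfrac{\max(\mathbf{Y}_\ell,0)}{\max(\mathbf{Z}_\ell,\varepsilon)}\in\mathbb{R}^{d\times d}$. *)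

theory Defs
  imports "HOL-Analysis.Analysis"
begin

text \<open>Eigenvalues of a real matrix are taken over the complex numbers.\<close>

definition eigenvalue :: "real^'d^'d \<Rightarrow> complex \<Rightarrow> bool" where
  "eigenvalue A z \<longleftrightarrow>
     (\<exists>v :: complex^'d. v \<noteq> 0 \<and> (\<chi> i j. complex_of_real (A $ i $ j)) *v v = z *s v)"

definition graph_laplacian_matrix :: "real^'d^'d \<Rightarrow> bool" where
  "graph_laplacian_matrix A \<longleftrightarrow>
     (\<forall>i. A $ i $ i \<le> 0) \<and> (\<forall>i j. i \<noteq> j \<longrightarrow> 0 \<le> A $ i $ j) \<and> (\<forall>j. (\<Sum>i\<in>UNIV. A $ i $ j) = 0)"

definition M_matrix :: "real^'d^'d \<Rightarrow> bool" where
  "M_matrix A \<longleftrightarrow>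
     (\<forall>i. 0 < A $ i $ i) \<and> (\<forall>i j. i \<noteq> j \<longrightarrow> A $ i $ j \<le> 0) \<and> (\<forall>z. eigenvalue A z \<longrightarrow> 0 < Re z)"

text \<open>The system \<open>y' = G(t,y) y\<close> with its standing assumptions. The invariants are
  \<open>w 1, \<dots>, w M\<close>, of which \<open>w 1\<close> is the vector of ones. The sign conditions are required
  only for \<open>t \<ge> t0\<close> and non-negative \<open>y\<close>, the other conditions everywhere.\<close>

definition graph_laplacian_system ::
    "real \<Rightarrow> nat \<Rightarrow> (nat \<Rightarrow> real^'d) \<Rightarrow> (real \<Rightarrow> real^'d \<Rightarrow> real^'d^'d) \<Rightarrow> bool" where
  "graph_laplacian_system t0 M w G \<longleftrightarrow>
     (\<forall>t y z. eigenvalue (G t y) z \<longrightarrow> Re z \<le> 0) \<and>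
     (\<forall>t y. t0 \<le> t \<and> (\<forall>k. 0 \<le> y $ k) \<longrightarrow>
        (\<forall>i. G t y $ i $ i \<le> 0) \<and> (\<forall>i j. i \<noteq> j \<longrightarrow> 0 \<le> G t y $ i $ j)) \<and>
     1 \<le> M \<and> M < CARD('d) \<and> w 1 = (\<chi> k. 1) \<and>
     (\<forall>j\<in>{1..M}. \<forall>t y. w j v* G t y = 0)"

text \<open>Coefficients of a stiffly accurate SDIRK method with \<open>s\<close> stages, indexed by \<open>1, \<dots>, s\<close>;
  the values \<open>a i j\<close> with \<open>j > i\<close> are never used.\<close>

definition sdirk_coefficients :: "nat \<Rightarrow> (nat \<Rightarrow> nat \<Rightarrow> real) \<Rightarrow> (nat \<Rightarrow> real) \<Rightarrow> bool" where
  "sdirk_coefficients s a b \<longleftrightarrow>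
     1 \<le> s \<and> (\<forall>i\<in>{1..s}. \<forall>j\<in>{1..s}. a i i = a j j) \<and> (\<forall>j\<in>{1..s}. b j = a s j)"

text \<open>\<open>\<tau> j\<close> is the time at which \<open>G\<close> is evaluated in stage \<open>j\<close>.\<close>

definition sdirk_step ::
    "nat \<Rightarrow> (nat \<Rightarrow> nat \<Rightarrow> real) \<Rightarrow> (nat \<Rightarrow> real) \<Rightarrow> (real \<Rightarrow> real^'d \<Rightarrow> real^'d^'d) \<Rightarrow>
     (nat \<Rightarrow> real) \<Rightarrow> real \<Rightarrow> real^'d \<Rightarrow> (nat \<Rightarrow> real^'d) \<Rightarrow> real^'d \<Rightarrow> bool" where
  "sdirk_step s a b G \<tau> h y Y yp \<longleftrightarrow>
     (\<forall>i\<in>{1..s}. Y i = y + h *\<^sub>R (\<Sum>j=1..i. a i j *\<^sub>R (G (\<tau> j) (Y j) *v Y j))) \<and>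
     yp = y + h *\<^sub>R (\<Sum>j=1..s. b j *\<^sub>R (G (\<tau> j) (Y j) *v Y j))"

definition clip :: "real^'d \<Rightarrow> real^'d" where
  "clip Y = (\<chi> l. max (Y $ l) 0)"

definition ratio_scaling :: "real \<Rightarrow> real^'d \<Rightarrow> real^'d \<Rightarrow> real^'d^'d" where
  "ratio_scaling \<epsilon> Y Z = (\<chi> k l. if k = l then max (Y $ l) 0 / max (Z $ l) \<epsilon> else 0)"

end

theory Submission
  imports Defs
begin

text \<open>All columns of a graph Laplacian matrix sum to zero, so \<open>A = I - hG\<close> is strictly diagonally
  dominant by columns. Summing the components of \<open>A x\<close> over the index set \<open>N\<close> where \<open>x\<close> is
  negative gives at most the sum of \<open>x\<close> over \<open>N\<close>; hence \<open>A x \<succeq> 0\<close> forces \<open>N\<close> to be empty.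
  Injectivity of \<open>A\<close> and non-negativity of its inverse follow; a vanishing component of a
  non-negative \<open>x\<close> makes that component of \<open>A x\<close> at most zero, which gives strict positivity.
  The eigenvalue bound is a column version of Gershgorin's theorem.\<close>

section \<open>Positivity and invertibility of I - hG for a graph Laplacian matrix G\<close>

lemma id_minus_scaled_mult_component:
  fixes G :: "real^'d^'d"
  shows "((mat 1 - h *\<^sub>R G) *v x) $ i = x $ i - h * (\<Sum>j\<in>UNIV. G $ i $ j * x $ j)"
  by (simp add: matrix_vector_mult_diff_rdistrib scaleR_matrix_vector_assoc[symmetric])
    (simp add: matrix_vector_mult_def)

lemma id_minus_laplacian_monotone:
  fixes G :: "real^'d^'d"
  assumes G: "graph_laplacian_matrix G" and h: "0 \<le> h"
    and nonneg: "\<And>i. 0 \<le> ((mat 1 - h *\<^sub>R G) *v x) $ i"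
  shows "0 \<le> x $ k"
proof (rule ccontr)
  define N where "N = {i. x $ i < 0}"
  assume "\<not> 0 \<le> x $ k"
  then have k: "k \<in> N" by (simp add: N_def)
  \<comment> \<open>Both factors have the same sign. For \<open>j\<close> in \<open>N\<close>, the
    rows outside \<open>N\<close> contribute only off-diagonal entries to a column with sum zero, so
    the part over \<open>N\<close> is non-positive, as is \<open>x $ j\<close>. For \<open>j\<close>
    outside \<open>N\<close>, the part over \<open>N\<close> is purely off-diagonal.\<close>
  have term_nonneg: "0 \<le> (\<Sum>i\<in>N. G $ i $ j) * x $ j" for j
  proof (cases "j \<in> N")
    case True
    have "(\<Sum>i\<in>UNIV. G $ i $ j) = (\<Sum>i\<in>N. G $ i $ j) + (\<Sum>i\<in>-N. G $ i $ j)"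
      by (simp add: sum.subset_diff[of N UNIV] Compl_eq_Diff_UNIV)
    moreover have "0 \<le> (\<Sum>i\<in>-N. G $ i $ j)"
      using G True by (intro sum_nonneg) (metis ComplD graph_laplacian_matrix_def)
    ultimately have "(\<Sum>i\<in>N. G $ i $ j) \<le> 0"
      using G by (simp add: graph_laplacian_matrix_def)
    then show ?thesis
      using True by (simp add: N_def mult_nonpos_nonpos)
  next
    case False
    then have "0 \<le> (\<Sum>i\<in>N. G $ i $ j)"
      using G by (intro sum_nonneg) (metis graph_laplacian_matrix_def)
    then show ?thesis
      using False by (simp add: N_def)
  qed
  have "(\<Sum>i\<in>N. ((mat 1 - h *\<^sub>R G) *v x) $ i)
      = (\<Sum>i\<in>N. x $ i) - h * (\<Sum>i\<in>N. \<Sum>j\<in>UNIV. G $ i $ j * x $ j)"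
    by (simp add: id_minus_scaled_mult_component sum_subtractf sum_distrib_left)
  also have "(\<Sum>i\<in>N. \<Sum>j\<in>UNIV. G $ i $ j * x $ j) = (\<Sum>j\<in>UNIV. (\<Sum>i\<in>N. G $ i $ j) * x $ j)"
    by (subst sum.swap) (simp add: sum_distrib_right)
  also have "(\<Sum>i\<in>N. x $ i) - h * \<dots> \<le> (\<Sum>i\<in>N. x $ i)"
    using mult_nonneg_nonneg[OF h sum_nonneg[of UNIV "\<lambda>j. (\<Sum>i\<in>N. G $ i $ j) * x $ j", OF term_nonneg]]
    by linarith
  also have "\<dots> < 0"
  proof -
    have "(\<Sum>i\<in>N. x $ i) < (\<Sum>i\<in>N. 0)"
      using k by (intro sum_strict_mono) (auto simp: N_def)
    then show ?thesis by simp
  qed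
  finally show False
    using sum_nonneg[of N, OF nonneg] by (simp only: not_less[symmetric])
qed

lemma id_minus_laplacian_invertible:
  fixes G :: "real^'d^'d"
  assumes G: "graph_laplacian_matrix G" and h: "0 \<le> h"
  shows "invertible (mat 1 - h *\<^sub>R G)"
proof -
  have "x = 0" if x: "(mat 1 - h *\<^sub>R G) *v x = 0" for x
  proof -
    \<comment> \<open>A kernel vector and its negative both have a non-negative image, so
      monotonicity bounds each component from both sides.\<close>
    have "(mat 1 - h *\<^sub>R G) *v (- x) = 0"
      using x by (simp add: linear_neg matrix_vector_mul_linear)
    then have "0 \<le> x $ k \<and> 0 \<le> (- x) $ k" for k
      using x id_minus_laplacian_monotone[OF G h, of x k]
        id_minus_laplacian_monotone[OF G h, of "- x" k] by simp
    then show "x = 0"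
      by (simp add: vec_eq_iff) (meson antisym)
  qed
  then have "\<exists>B. B ** (mat 1 - h *\<^sub>R G) = mat 1"
    by (simp add: matrix_left_invertible_ker)
  then show ?thesis
    using invertible_left_inverse by blast
qed

lemma matrix_inv_right_mult:
  fixes A :: "real^'d^'d"
  assumes "invertible A"
  shows "A *v (matrix_inv A *v x) = x"
proof -
  have "A ** matrix_inv A = mat 1"
    using assms unfolding invertible_def matrix_inv_def by (rule someI2_ex) simp
  then show ?thesis
    by (simp add: matrix_vector_mul_assoc)
qed

lemma id_minus_laplacian_inverse_nonneg:
  fixes G :: "real^'d^'d"
  assumes G: "graph_laplacian_matrix G" and h: "0 \<le> h"
  shows "0 \<le> matrix_inv (mat 1 - h *\<^sub>R G) $ k $ l"
proof -
  let ?A = "mat 1 - h *\<^sub>R G"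
  \<comment> \<open>Column \<open>l\<close> of the inverse solves the linear system whose right-hand
    side is the unit vector \<open>axis l 1\<close>, which is non-negative.\<close>
  have column: "?A *v (matrix_inv ?A *v axis l 1) = axis l 1"
    by (rule matrix_inv_right_mult[OF id_minus_laplacian_invertible[OF G h]])
  have "0 \<le> (matrix_inv ?A *v axis l 1) $ k"
    by (rule id_minus_laplacian_monotone[OF G h]) (simp only: column, simp add: axis_def)
  then show ?thesis
    by (simp add: matrix_vector_mult_basis column_def)
qed

lemma id_minus_laplacian_solution_pos:
  fixes G :: "real^'d^'d"
  assumes G: "graph_laplacian_matrix G" and h: "0 \<le> h"
    and pos: "\<And>i. 0 < ((mat 1 - h *\<^sub>R G) *v x) $ i"
  shows "0 < x $ k"
proof (rule ccontr)
  have nonneg: "0 \<le> x $ i" for i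
    using id_minus_laplacian_monotone[OF G h] pos less_imp_le by blast
  assume "\<not> 0 < x $ k"
  with nonneg[of k] have zero: "x $ k = 0" by simp
  \<comment> \<open>The only possibly negative coefficient in row \<open>k\<close> is the diagonal
    one, and it is multiplied by \<open>x $ k = 0\<close>.\<close>
  have "0 \<le> G $ k $ j * x $ j" for j
    using G nonneg zero by (cases "j = k") (auto simp: graph_laplacian_matrix_def)
  then have "0 \<le> h * (\<Sum>j\<in>UNIV. G $ k $ j * x $ j)"
    using h by (simp add: sum_nonneg)
  with pos[of k] zero show False
    by (simp add: id_minus_scaled_mult_component)
qed

section \<open>Spectrum and conserved functionals of I - hG\<close>

lemma id_minus_laplacian_eigenvalue_Re_pos:
  fixes G :: "real^'d^'d"
  assumes G: "graph_laplacian_matrix G" and h: "0 \<le> h"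
    and ev: "eigenvalue (mat 1 - h *\<^sub>R G) z"
  shows "0 < Re z"
proof (rule ccontr)
  assume "\<not> 0 < Re z"
  then have z: "Re z \<le> 0" by simp
  from ev obtain v :: "complex^'d" where v: "v \<noteq> 0"
    and eq: "(\<chi> i j. complex_of_real ((mat 1 - h *\<^sub>R G) $ i $ j)) *v v = z *s v"
    unfolding eigenvalue_def by blast
  \<comment> \<open>Row \<open>i\<close> of the eigenvector equation is solved for its diagonal part
    and moduli are taken. The diagonal term h G_ii |v_i| is finally moved to the right, so that
    complete columns of \<open>G\<close> appear once the bounds are summed over
    \<open>i\<close>.\<close>
  have bound: "cmod (v $ i) \<le> h * (\<Sum>j\<in>UNIV. G $ i $ j * cmod (v $ j))" for i
  proof -
    let ?S = "\<Sum>j\<in>UNIV - {i}. complex_of_real (G $ i $ j) * v $ j"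
    have "(\<Sum>j\<in>UNIV. complex_of_real ((mat 1 - h *\<^sub>R G) $ i $ j) * v $ j) = z * v $ i"
      using eq by (simp add: vec_eq_iff matrix_vector_mult_def)
    then have "complex_of_real (1 - h * G $ i $ i) * v $ i
        + (\<Sum>j\<in>UNIV - {i}. complex_of_real ((mat 1 - h *\<^sub>R G) $ i $ j) * v $ j) = z * v $ i"
      by (simp add: sum.remove[of UNIV i] mat_def)
    moreover have "(\<Sum>j\<in>UNIV - {i}. complex_of_real ((mat 1 - h *\<^sub>R G) $ i $ j) * v $ j)
        = - of_real h * ?S"
      unfolding sum_distrib_left by (rule sum.cong) (auto simp: mat_def)
    ultimately have "(of_real (1 - h * G $ i $ i) - z) * v $ i = of_real h * ?S"
      by (simp add: algebra_simps)
    from arg_cong[OF this, of cmod]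
    have factored: "cmod (of_real (1 - h * G $ i $ i) - z) * cmod (v $ i) = h * cmod ?S"
      using h by (simp only: norm_mult norm_of_real abs_of_nonneg)
    \<comment> \<open>Subtracting \<open>z\<close> with \<open>Re z \<le> 0\<close> can only
      increase the real part.\<close>
    have "1 - h * G $ i $ i \<le> cmod (of_real (1 - h * G $ i $ i) - z)"
      using z complex_Re_le_cmod[of "of_real (1 - h * G $ i $ i) - z"] by simp
    from mult_right_mono[OF this norm_ge_zero[of "v $ i"]]
    have "(1 - h * G $ i $ i) * cmod (v $ i) \<le> h * cmod ?S"
      unfolding factored .
    also have "\<dots> \<le> h * (\<Sum>j\<in>UNIV - {i}. G $ i $ j * cmod (v $ j))"
      using G h by (intro mult_left_mono sum_norm_le)
        (auto simp: norm_mult graph_laplacian_matrix_def)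
    finally show ?thesis
      by (simp add: sum.remove[of UNIV i] algebra_simps)
  qed
  \<comment> \<open>Summing all rows, instead of picking a largest component as in the row version,
    brings in the zero column sums and forces \<open>v = 0\<close>.\<close>
  have "(\<Sum>i\<in>UNIV. cmod (v $ i)) \<le> (\<Sum>i\<in>UNIV. h * (\<Sum>j\<in>UNIV. G $ i $ j * cmod (v $ j)))"
    by (intro sum_mono bound)
  also have "\<dots> = h * (\<Sum>j\<in>UNIV. (\<Sum>i\<in>UNIV. G $ i $ j) * cmod (v $ j))"
    unfolding sum_distrib_left[symmetric] by (subst sum.swap) (simp add: sum_distrib_right)
  also have "\<dots> = 0"
    using G by (simp add: graph_laplacian_matrix_def)
  finally have "(\<Sum>i\<in>UNIV. cmod (v $ i)) = 0"
    by (simp add: antisym sum_nonneg)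
  then have "v = 0"
    by (simp add: sum_nonneg_eq_0_iff vec_eq_iff)
  with v show False by simp
qed

lemma id_minus_laplacian_M_matrix:
  fixes G :: "real^'d^'d"
  assumes G: "graph_laplacian_matrix G" and h: "0 \<le> h"
  shows "M_matrix (mat 1 - h *\<^sub>R G)"
proof -
  have "0 < (mat 1 - h *\<^sub>R G) $ i $ i" for i
    using G mult_nonneg_nonpos[OF h, of "G $ i $ i"]
    by (auto simp: graph_laplacian_matrix_def mat_def intro: le_less_trans)
  moreover have "(mat 1 - h *\<^sub>R G) $ i $ j \<le> 0" if "i \<noteq> j" for i j
    using that G h by (simp add: graph_laplacian_matrix_def mat_def)
  ultimately show ?thesis
    using id_minus_laplacian_eigenvalue_Re_pos[OF G h] by (simp add: M_matrix_def)
qed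

text \<open>A left kernel vector of \<open>G\<close> is a left eigenvector of I - hG with eigenvalue
  1. This carries a linear invariant through the implicit solve.\<close>

lemma id_minus_conserves:
  fixes G :: "real^'d^'d"
  assumes "u v* G = 0"
  shows "u \<bullet> ((mat 1 - h *\<^sub>R G) *v x) = u \<bullet> x"
proof -
  have "u \<bullet> (G *v x) = 0"
    using assms by (simp add: dot_lmul_matrix[symmetric])
  then show ?thesis
    by (simp add: matrix_vector_mult_diff_rdistrib scaleR_matrix_vector_assoc[symmetric]
        inner_diff_right)
qed

section \<open>Weighted sums of column-scaled matrices\<close>

lemma mult_ratio_scaling_component:
  "(A ** ratio_scaling \<epsilon> Y Z) $ i $ j = A $ i $ j * (max (Y $ j) 0 / max (Z $ j) \<epsilon>)"
  by (simp add: matrix_matrix_mult_def ratio_scaling_def if_distrib cong: if_cong)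

text \<open>The diagonal scaling acts from the right, so its factor depends on the column alone and
  comes out of the sum over rows.\<close>

lemma ratio_scaling_sum_left_kernel:
  fixes A :: "'i \<Rightarrow> real^'d^'d"
  assumes "\<And>k. k \<in> K \<Longrightarrow> u v* A k = 0"
  shows "u v* (\<Sum>k\<in>K. b k *\<^sub>R (A k ** ratio_scaling \<epsilon> (Y k) Z)) = 0"
proof -
  let ?\<sigma> = "\<lambda>k j. max (Y k $ j) 0 / max (Z $ j) \<epsilon>"
  have "(\<Sum>i\<in>UNIV. u $ i * (\<Sum>k\<in>K. b k *\<^sub>R (A k ** ratio_scaling \<epsilon> (Y k) Z)) $ i $ j)
      = (\<Sum>i\<in>UNIV. \<Sum>k\<in>K. (b k * ?\<sigma> k j) * (u $ i * A k $ i $ j))" for j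
    by (simp add: mult_ratio_scaling_component sum_distrib_left mult_ac)
  also have "\<dots> j = (\<Sum>k\<in>K. \<Sum>i\<in>UNIV. (b k * ?\<sigma> k j) * (u $ i * A k $ i $ j))" for j
    by (rule sum.swap)
  also have "\<dots> j = (\<Sum>k\<in>K. (b k * ?\<sigma> k j) * (u v* A k) $ j)" for j
    by (simp only: vector_matrix_mult_def vec_lambda_beta sum_distrib_left)
  also have "\<dots> j = 0" for j
    using assms by simp
  finally show ?thesis
    by (simp add: vec_eq_iff vector_matrix_mult_def)
qed

lemma ratio_scaling_sum_laplacian:
  fixes A :: "'i \<Rightarrow> real^'d^'d"
  assumes A: "\<And>k. k \<in> K \<Longrightarrow> graph_laplacian_matrix (A k)"
    and b: "\<And>k. k \<in> K \<Longrightarrow> 0 \<le> b k" and \<epsilon>: "0 < \<epsilon>"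
  shows "graph_laplacian_matrix (\<Sum>k\<in>K. b k *\<^sub>R (A k ** ratio_scaling \<epsilon> (Y k) Z))"
proof -
  let ?B = "\<Sum>k\<in>K. b k *\<^sub>R (A k ** ratio_scaling \<epsilon> (Y k) Z)"
  let ?\<sigma> = "\<lambda>k j. max (Y k $ j) 0 / max (Z $ j) \<epsilon>"
  have component: "?B $ i $ j = (\<Sum>k\<in>K. (b k * ?\<sigma> k j) * A k $ i $ j)" for i j
    by (simp add: mult_ratio_scaling_component mult_ac)
  \<comment> \<open>The numerator is cut off at zero and the threshold keeps the denominator
    positive, whatever the signs in \<open>Y k\<close> and \<open>Z\<close>. Hence the sign pattern
    of each \<open>A k\<close> survives scaling and summation.\<close>
  have \<sigma>: "0 \<le> b k * ?\<sigma> k j" if "k \<in> K" for k j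
    using b[OF that] \<epsilon> by (intro mult_nonneg_nonneg divide_nonneg_nonneg) auto
  have "?B $ i $ i \<le> 0" for i
    unfolding component using A \<sigma>
    by (intro sum_nonpos mult_nonneg_nonpos) (auto simp: graph_laplacian_matrix_def)
  moreover have "0 \<le> ?B $ i $ j" if "i \<noteq> j" for i j
    unfolding component
  proof (intro sum_nonneg)
    fix k assume "k \<in> K"
    then show "0 \<le> (b k * ?\<sigma> k j) * A k $ i $ j"
      using A \<sigma> that by (intro mult_nonneg_nonneg[OF \<sigma>]) (auto simp: graph_laplacian_matrix_def)
  qed
  moreover have "(\<Sum>i\<in>UNIV. ?B $ i $ j) = 0" for j
  proof -
    \<comment> \<open>Zero column sums say that the vector of ones is in the left kernel, which
      scaling and summation preserve.\<close>
    have "(\<chi> i. 1) v* A k = 0" if "k \<in> K" for k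
      using A[OF that] by (simp add: graph_laplacian_matrix_def vector_matrix_mult_def vec_eq_iff)
    then have "((\<chi> i. 1) v* ?B) $ j = 0"
      by (subst ratio_scaling_sum_left_kernel) auto
    then show ?thesis
      by (simp add: vector_matrix_mult_def)
  qed
  ultimately show ?thesis
    by (simp add: graph_laplacian_matrix_def)
qed

section \<open>The corrected solution of the SDIRK step\<close>

lemma graph_laplacian_system_laplacian:
  assumes system: "graph_laplacian_system t0 M w G"
    and "t0 \<le> t" and "\<And>k. 0 \<le> y $ k"
  shows "graph_laplacian_matrix (G t y)"
proof -
  \<comment> \<open>The invariant with index 1 is the vector of ones, so it yields the zero column
    sums.\<close>
  have w1: "w 1 = (\<chi> k. 1)" and "1 \<in> {1..M}" and "\<forall>j\<in>{1..M}. w j v* G t y = 0"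
    using system unfolding graph_laplacian_system_def by simp_all
  then have "w 1 v* G t y = 0" by blast
  then have "(\<Sum>i\<in>UNIV. G t y $ i $ j) = 0" for j
    by (simp add: w1[simplified] vector_matrix_mult_def vec_eq_iff)
  with assms show ?thesis
    by (simp add: graph_laplacian_system_def graph_laplacian_matrix_def)
qed

theorem mainTheorem2:
  fixes G :: "real \<Rightarrow> real^'d \<Rightarrow> real^'d^'d"
    and w :: "nat \<Rightarrow> real^'d" and M s :: nat
    and a :: "nat \<Rightarrow> nat \<Rightarrow> real" and b c :: "nat \<Rightarrow> real"
    and t0 tn h \<epsilon> :: real
    and yn yp ynext :: "real^'d" and Y :: "nat \<Rightarrow> real^'d"
    and Gbar :: "real^'d^'d"
  assumes system: "graph_laplacian_system t0 M w G"
    and coefficients: "sdirk_coefficients s a b"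
    and weights: "\<forall>j\<in>{1..s}. 0 \<le> b j"
    and h: "0 < h" and \<epsilon>: "0 < \<epsilon>"
    and times: "\<forall>j\<in>{1..s}. t0 \<le> tn + c j * h"
    and step: "sdirk_step s a b G (\<lambda>j. tn + c j * h) h yn Y yp"
    and Gbar: "Gbar = (\<Sum>j=1..s. b j *\<^sub>R (G (tn + c j * h) (clip (Y j)) ** ratio_scaling \<epsilon> (Y j) yp))"
    and ynext: "ynext = matrix_inv (mat 1 - h *\<^sub>R Gbar) *v yn"
  shows "graph_laplacian_matrix Gbar \<and>
    (\<forall>j\<in>{1..M}. w j v* Gbar = 0) \<and>
    invertible (mat 1 - h *\<^sub>R Gbar) \<and>
    M_matrix (mat 1 - h *\<^sub>R Gbar) \<and>
    (\<forall>k l. 0 \<le> matrix_inv (mat 1 - h *\<^sub>R Gbar) $ k $ l) \<and>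
    ((\<forall>k. 0 \<le> yn $ k) \<longrightarrow> (\<forall>k. 0 \<le> ynext $ k)) \<and>
    ((\<forall>k. 0 < yn $ k) \<longrightarrow> (\<forall>k. 0 < ynext $ k)) \<and>
    (\<forall>j\<in>{1..M}. w j \<bullet> ynext = w j \<bullet> yn)"
proof -
  let ?A = "mat 1 - h *\<^sub>R Gbar"
  have h0: "0 \<le> h" using h by simp
  \<comment> \<open>Clipping moves possibly negative stages into the non-negative orthant, where the
    sign conditions on \<open>G\<close> are available.\<close>
  have L: "graph_laplacian_matrix Gbar"
    unfolding Gbar
  proof (rule ratio_scaling_sum_laplacian[OF _ _ \<epsilon>])
    fix j assume "j \<in> {1..s}"
    then show "graph_laplacian_matrix (G (tn + c j * h) (clip (Y j)))"
      using times by (intro graph_laplacian_system_laplacian[OF system]) (auto simp: clip_def)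
    show "0 \<le> b j" using weights \<open>j \<in> {1..s}\<close> by blast
  qed
  have W: "w j v* Gbar = 0" if "j \<in> {1..M}" for j
    unfolding Gbar using system that
    by (intro ratio_scaling_sum_left_kernel) (simp add: graph_laplacian_system_def)
  have inv: "invertible ?A" by (rule id_minus_laplacian_invertible[OF L h0])
  \<comment> \<open>In this form positivity and conservation are statements about a solution of a
    linear system with right-hand side \<open>yn\<close>.\<close>
  have sol: "?A *v ynext = yn" unfolding ynext by (rule matrix_inv_right_mult[OF inv])
  show ?thesis
  proof (intro conjI)
    show "\<forall>j\<in>{1..M}. w j v* Gbar = 0" using W by blast
    show "\<forall>k l. 0 \<le> matrix_inv ?A $ k $ l"
      using id_minus_laplacian_inverse_nonneg[OF L h0] by blast
    show "(\<forall>k. 0 \<le> yn $ k) \<longrightarrow> (\<forall>k. 0 \<le> ynext $ k)"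
      using id_minus_laplacian_monotone[OF L h0, of ynext] by (simp add: sol)
    show "(\<forall>k. 0 < yn $ k) \<longrightarrow> (\<forall>k. 0 < ynext $ k)"
      using id_minus_laplacian_solution_pos[OF L h0, of ynext] by (simp add: sol)
    show "\<forall>j\<in>{1..M}. w j \<bullet> ynext = w j \<bullet> yn"
      using id_minus_conserves[OF W, of _ h ynext] by (simp add: sol)
  qed (fact L inv id_minus_laplacian_M_matrix[OF L h0])+
qed

end
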